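(* For every pair of distinct objectives among the following four — total arrival time $\sum_{i=1}^n t_i$, makespan $\max_{1\le i\le n} t_i$, total distance $\sum_{i=1}^n len(p_i)$, and maximum distance $\max_{1\le i\le n} len(p_i)$ — a solution that simultaneously minimizes both objectives cannot always be found. That is, for each such pair there exists an instance $(G,R,x_I,x_G)$ of the multi-robot path planning problem (MPP) that has at least one solution, but for which no solution $P=\{p_1,\ldots,p_n\}$ simultaneously attains the minimum, over all solutions of that instance, of both objectives in the pair.
   Context: An MPP (multi-robot path planning on graphs) instance is a 4-tuple $(G,R,x_I,x_G)$ where $G=(V,E)$ is a finite connected, undirected, simple graph, $R=\{r_1,\ldots,r_n\}$ is a set of $n$ robots, and $x_I,x_G:R\to V$ are injective maps (the start and goal configurations). Write $\mathbb Z^+=\{0,1,2,\ldots\}$ for the discrete time steps. A scheduled path is a map $p_i:\mathbb Z^+\to V$. It is feasible for robot $r_i$ if: $p_i(0)=x_I(r_i)$; there is a smallest $t_i\in\mathbb Z^+$ (the arrival time of $r_i$) such that $p_i(t)=x_G(r_i)$ for all $t\ge t_i$; and for all $0\le t<t_i$, either $(p_i(t),p_i(t+1))\in E$ or $p_i(t)=p_i(t+1)$. Two paths $p_i,p_j$ ($i\ne j$) are in collision if there is $t\in\mathbb Z^+$ such that $p_i(t)=p_j(t)$ (meet collision) or $(p_i(t),p_i(t+1))=(p_j(t+1),p_j(t))$ (head-on collision). In particular, synchronous rotation of robots along a fully occupied cycle is allowed. A solution is a set $P=\{p_1,\ldots,p_n\}$ such that each $p_i$ is a feasible path for $r_i$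 and no two of the paths are in collision. The length $len(p_i)$ is the number of $t$ with $p_i(t)\neq p_i(t+1)$, i.e. the number of edge traversals counted with multiplicity. *)

theory Defs
  imports "Graph_Theory.Graph_Theory"
begin

text \<open>
  Undirected simple graphs are symmetric loop-free digraphs without parallel arcs
  (\<^locale>\<open>pair_graph\<close>): an undirected edge is represented by its two orientations.
\<close>

record ('v, 'r) mpp =
  mpp_graph :: "'v pair_pre_digraph"
  robots :: "'r set"
  start :: "'r \<Rightarrow> 'v"
  goal :: "'r \<Rightarrow> 'v"

definition mpp_instance :: "('v, 'r) mpp \<Rightarrow> bool" where
  "mpp_instance I \<longleftrightarrow>
     pair_graph (mpp_graph I) \<and> Digraph_Component.connected (with_proj (mpp_graph I)) \<and>
     finite (robots I) \<and> robots I \<noteq> {} \<and>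
     start I ` robots I \<subseteq> pverts (mpp_graph I) \<and> inj_on (start I) (robots I) \<and>
     goal I ` robots I \<subseteq> pverts (mpp_graph I) \<and> inj_on (goal I) (robots I)"

type_synonym 'v scheduled_path = "nat \<Rightarrow> 'v"

text \<open>Only meaningful if the path is eventually constantly at the goal of the robot.\<close>

definition arrival_time :: "('v, 'r) mpp \<Rightarrow> 'r \<Rightarrow> 'v scheduled_path \<Rightarrow> nat" where
  "arrival_time I r p = (LEAST T. \<forall>t\<ge>T. p t = goal I r)"

definition feasible :: "('v, 'r) mpp \<Rightarrow> 'r \<Rightarrow> 'v scheduled_path \<Rightarrow> bool" where
  "feasible I r p \<longleftrightarrow>
     (\<forall>t. p t \<in> pverts (mpp_graph I)) \<and>
     p 0 = start I r \<and>
     (\<exists>T. \<forall>t\<ge>T. p t = goal I r) \<and>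
     (\<forall>t<arrival_time I r p. (p t, p (Suc t)) \<in> parcs (mpp_graph I) \<or> p t = p (Suc t))"

definition in_collision :: "'v scheduled_path \<Rightarrow> 'v scheduled_path \<Rightarrow> bool" where
  "in_collision p q \<longleftrightarrow> (\<exists>t. p t = q t \<or> (p t, p (Suc t)) = (q (Suc t), q t))"

text \<open>
  A solution is given as a family of paths indexed by robots; its values outside the set of
  robots of the instance are irrelevant.
\<close>

definition solution :: "('v, 'r) mpp \<Rightarrow> ('r \<Rightarrow> 'v scheduled_path) \<Rightarrow> bool" where
  "solution I P \<longleftrightarrow>
     (\<forall>r\<in>robots I. feasible I r (P r)) \<and>
     (\<forall>r\<in>robots I. \<forall>s\<in>robots I. r \<noteq> s \<longrightarrow> \<not> in_collision (P r) (P s))"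

text \<open>The set of moves is finite for every feasible path.\<close>

definition len :: "'v scheduled_path \<Rightarrow> nat" where
  "len p = card {t. p t \<noteq> p (Suc t)}"

datatype objective = Total_Arrival_Time | Makespan | Total_Distance | Maximum_Distance

fun cost :: "('v, 'r) mpp \<Rightarrow> objective \<Rightarrow> ('r \<Rightarrow> 'v scheduled_path) \<Rightarrow> nat" where
  "cost I Total_Arrival_Time P = (\<Sum>r\<in>robots I. arrival_time I r (P r))"
| "cost I Makespan P = Max ((\<lambda>r. arrival_time I r (P r)) ` robots I)"
| "cost I Total_Distance P = (\<Sum>r\<in>robots I. len (P r))"
| "cost I Maximum_Distance P = Max ((\<lambda>r. len (P r)) ` robots I)"

end

theory Submission
  imports Defs
begin

text \<open>
  Two instances with two robots each suffice. In the first one, a robot stands at its goal, on the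
  unique shortest route of the other: either the other robot takes a detour, which is best for both
  totals, or the standing robot briefly steps aside, which is best for both maxima. In the second
  one, two robots have to traverse a common corridor in opposite directions: either one
  of them waits for two steps, which is best for both distances, or it takes a detour that is longer
  by one edge, which is best for both arrival times.
\<close>

subsection \<open>Arrival times and lengths\<close>

lemma arrival_time_le:
  assumes "\<And>t. t \<ge> T \<Longrightarrow> p t = goal I r"
  shows "arrival_time I r p \<le> T"
  unfolding arrival_time_def using assms by (intro Least_le) auto

lemma feasible_after_arrival:
  assumes "feasible I r p" "t \<ge> arrival_time I r p"
  shows "p t = goal I r"
proof -
  have "\<exists>T. \<forall>t\<ge>T. p t = goal I r"
    using assms(1) by (simp add: feasible_def)
  then have "\<forall>t\<ge>arrival_time I r p. p t = goal I r"
    unfolding arrival_time_def by (rule LeastI_ex)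
  with assms(2) show ?thesis by blast
qed

text \<open>\<open>feasible\<close> constrains moves only before the arrival time; afterwards the
  path is constant, so a change of position is always an edge.\<close>

lemma feasible_step:
  assumes "feasible I r p" "p t \<noteq> p (Suc t)"
  shows "(p t, p (Suc t)) \<in> parcs (mpp_graph I)"
proof (cases "t < arrival_time I r p")
  case True
  then show ?thesis using assms by (auto simp: feasible_def)
next
  case False
  then show ?thesis using assms feasible_after_arrival[OF assms(1)] by simp
qed

lemma len_le_card:
  assumes "finite A" "\<And>t. p t \<noteq> p (Suc t) \<Longrightarrow> t \<in> A"
  shows "len p \<le> card A"
  unfolding len_def using assms by (intro card_mono) auto

lemma feasible_moves_before_arrival:
  assumes "feasible I r p" "p t \<noteq> p (Suc t)"
  shows "t < arrival_time I r p"
  using feasible_after_arrival[OF assms(1)] assms(2) by (metis le_Suc_eq not_less)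

text \<open>Every move happens at its own time before arrival. Bounds on arrival times thus pass to
  lengths, and lower bounds on lengths pass to arrival times.\<close>

lemma feasible_len_le_arrival_time:
  assumes "feasible I r p"
  shows "len p \<le> arrival_time I r p"
  using len_le_card[of "{..<arrival_time I r p}" p] feasible_moves_before_arrival[OF assms] by simp

lemma feasible_finite_moves:
  assumes "feasible I r p"
  shows "finite {t. p t \<noteq> p (Suc t)}"
  using feasible_moves_before_arrival[OF assms]
  by (intro finite_subset[OF _ finite_lessThan[of "arrival_time I r p"]]) auto

text \<open>A move lowers \<open>f\<close> by at most one and a wait leaves it alone. Typical
  \<open>f\<close>: the distance to a target, or the indicator of a vertex.\<close>

lemma potential_le_moves:
  fixes f :: "'v \<Rightarrow> nat"
  assumes "\<And>t. p t \<noteq> p (Suc t) \<Longrightarrow> f (p t) \<le> Suc (f (p (Suc t)))" "m \<le> n"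
  shows "f (p m) \<le> f (p n) + card {t \<in> {m..<n}. p t \<noteq> p (Suc t)}"
  using assms(2)
proof (induction n rule: dec_induct)
  case (step n)
  have "{t \<in> {m..<Suc n}. p t \<noteq> p (Suc t)} =
      {t \<in> {m..<n}. p t \<noteq> p (Suc t)} \<union> (if p n \<noteq> p (Suc n) then {n} else {})"
    using step.hyps by (auto simp: less_Suc_eq)
  moreover have "n \<notin> {t \<in> {m..<n}. p t \<noteq> p (Suc t)}" by simp
  ultimately show ?case
    using step.IH assms(1)[of n] by (cases "p n = p (Suc n)") auto
qed auto

lemma feasible_start_potential_le_len:
  fixes f :: "'v \<Rightarrow> nat"
  assumes "feasible I r p"
    and "\<And>u v. (u, v) \<in> parcs (mpp_graph I) \<Longrightarrow> f u \<le> Suc (f v)"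
    and "f (goal I r) = 0"
  shows "f (start I r) \<le> len p"
proof -
  let ?T = "arrival_time I r p"
  have "f (p 0) \<le> f (p ?T) + card {t \<in> {0..<?T}. p t \<noteq> p (Suc t)}"
    using assms feasible_step[OF assms(1)] by (intro potential_le_moves) auto
  also have "f (p ?T) = 0"
    using feasible_after_arrival[OF assms(1)] assms(3) by simp
  also have "card {t \<in> {0..<?T}. p t \<noteq> p (Suc t)} \<le> len p"
    unfolding len_def using feasible_finite_moves[OF assms(1)] by (intro card_mono) auto
  finally show ?thesis
    using assms(1) by (simp add: feasible_def)
qed

text \<open>A path with no more moves than the potential of its start has none to spare: each move
  must lower the potential by exactly one. This forces the routes in both instances.\<close>

lemma feasible_geodesic_step:
  fixes f :: "'v \<Rightarrow> nat"
  assumes feas: "feasible I r p"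
    and pot: "\<And>u v. (u, v) \<in> parcs (mpp_graph I) \<Longrightarrow> f u \<le> Suc (f v)"
    and "f (goal I r) = 0"
    and "len p \<le> f (start I r)"
    and move: "p t \<noteq> p (Suc t)"
  shows "f (p t) = Suc (f (p (Suc t)))"
proof -
  let ?M = "\<lambda>A. {t \<in> A. p t \<noteq> p (Suc t)}"
  let ?T = "arrival_time I r p"
  have t: "t < ?T" using feasible_moves_before_arrival[OF feas move] .
  note descent = potential_le_moves[of p f, OF pot[OF feasible_step[OF feas]]]
  have "f (p 0) \<le> f (p t) + card (?M {0..<t})"
    by (rule descent) auto
  moreover have "f (p (Suc t)) \<le> f (p ?T) + card (?M {Suc t..<?T})"
    using t by (intro descent) auto
  moreover have "f (p ?T) = 0"
    using feasible_after_arrival[OF feas] assms(3) by simp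
  \<comment> \<open>The moves before \<open>t\<close>, the one at \<open>t\<close> and those after
    it are disjoint.\<close>
  moreover have "card (?M {0..<t}) + 1 + card (?M {Suc t..<?T}) \<le> len p"
  proof -
    have "card (?M {0..<t}) + 1 + card (?M {Suc t..<?T})
        = card (insert t (?M {0..<t} \<union> ?M {Suc t..<?T}))"
      by (subst card_insert_disjoint, simp, simp, subst card_Un_disjoint) auto
    also have "\<dots> \<le> len p"
      unfolding len_def using feasible_finite_moves[OF feas] move by (intro card_mono) auto
    finally show ?thesis .
  qed
  moreover have "p 0 = start I r" using feas by (simp add: feasible_def)
  moreover have "f (p t) \<le> Suc (f (p (Suc t)))"
    using pot feasible_step[OF feas move] by blast
  ultimately show ?thesis
    using assms(4) by simp
qed

text \<open>Leaving the goal and coming back costs at least two moves.\<close>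

lemma feasible_closed_len_le_1:
  assumes feas: "feasible I r p" and "start I r = goal I r" "len p \<le> 1"
  shows "p t = goal I r"
proof (rule ccontr)
  let ?g = "goal I r" and ?T = "arrival_time I r p"
  let ?M = "\<lambda>A. {t \<in> A. p t \<noteq> p (Suc t)}"
  assume neq: "p t \<noteq> ?g"
  have t: "t < ?T" using feasible_after_arrival[OF feas] neq by (meson not_le)
  have "p 0 = ?g" using assms by (simp add: feasible_def)
  \<comment> \<open>The potentials are the indicator of the goal, which falls from 1 to 0 before
    \<open>t\<close>, and its complement, which does so between \<open>t\<close> and
    arrival.\<close>
  then have "1 \<le> card (?M {0..<t})"
    using potential_le_moves[of p "\<lambda>v. of_bool (v = ?g)" 0 t] neq by simp
  moreover have "1 \<le> card (?M {t..<?T})"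
    using potential_le_moves[of p "\<lambda>v. of_bool (v \<noteq> ?g)" t ?T] neq t
      feasible_after_arrival[OF feas, of ?T] by simp
  moreover have "card (?M {0..<t}) + card (?M {t..<?T}) = card (?M {0..<t} \<union> ?M {t..<?T})"
    by (subst card_Un_disjoint) auto
  moreover have "\<dots> \<le> len p"
    unfolding len_def using feasible_finite_moves[OF feas] by (intro card_mono) auto
  ultimately show False using assms(3) by simp
qed

subsection \<open>Scheduled paths given by lists\<close>

definition list_path :: "'v list \<Rightarrow> 'v scheduled_path" where
  "list_path xs t = xs ! min t (length xs - 1)"

lemma list_path_ge:
  assumes "xs \<noteq> []" "t \<ge> length xs - 1"
  shows "list_path xs t = last xs"
  using assms by (simp add: list_path_def last_conv_nth min_def)

lemma list_path_move:
  assumes "list_path xs t \<noteq> list_path xs (Suc t)"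
  shows "Suc t < length xs"
proof (rule ccontr)
  assume "\<not> Suc t < length xs"
  then have "min t (length xs - 1) = min (Suc t) (length xs - 1)" by auto
  with assms show False by (simp add: list_path_def)
qed

lemma feasible_list_path:
  assumes "xs \<noteq> []" "set xs \<subseteq> pverts (mpp_graph I)"
    and "hd xs = start I r" "last xs = goal I r"
    and "successively (\<lambda>u v. (u, v) \<in> parcs (mpp_graph I) \<or> u = v) xs"
  shows "feasible I r (list_path xs)"
  unfolding feasible_def
proof (intro conjI allI impI)
  fix t
  have "xs ! min t (length xs - 1) \<in> set xs"
    using assms(1) by (intro nth_mem) (simp add: min_less_iff_disj)
  then show "list_path xs t \<in> pverts (mpp_graph I)"
    using assms(2) by (auto simp: list_path_def)
next
  show "list_path xs 0 = start I r"
    using assms(1,3) by (simp add: list_path_def hd_conv_nth)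
next
  show "\<exists>T. \<forall>t\<ge>T. list_path xs t = goal I r"
    using list_path_ge[OF assms(1)] assms(4) by auto
next
  fix t
  show "(list_path xs t, list_path xs (Suc t)) \<in> parcs (mpp_graph I)
      \<or> list_path xs t = list_path xs (Suc t)"
  proof (cases "Suc t < length xs")
    case True
    then show ?thesis
      using assms(5) by (auto simp: successively_conv_nth list_path_def min_def)
  next
    case False
    then show ?thesis using list_path_move by blast
  qed
qed

lemma arrival_time_list_path:
  assumes "xs \<noteq> []" "last xs = goal I r"
  shows "arrival_time I r (list_path xs) \<le> length xs - 1"
  using list_path_ge[OF assms(1)] assms(2) by (intro arrival_time_le) simp

lemma len_list_path: "len (list_path xs) \<le> length xs - 1"
  using len_le_card[of "{..<length xs - 1}" "list_path xs"] list_path_move[of xs] by fastforce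

text \<open>Both paths are constant from time \<open>n\<close> on, so finitely many checks suffice:
  a swap at or after \<open>n\<close> would be a meeting at \<open>n\<close>.\<close>

lemma not_in_collision_list_path:
  assumes "xs \<noteq> []" "ys \<noteq> []" "length xs \<le> Suc n" "length ys \<le> Suc n"
    and "\<forall>t<Suc n. list_path xs t \<noteq> list_path ys t"
    and "\<forall>t<n. list_path xs t \<noteq> list_path ys (Suc t) \<or> list_path xs (Suc t) \<noteq> list_path ys t"
  shows "\<not> in_collision (list_path xs) (list_path ys)"
proof -
  have const: "list_path xs t = list_path xs n" "list_path ys t = list_path ys n" if "t \<ge> n" for t
    using that assms(1-4) by (auto simp: list_path_ge)
  have meet: "list_path xs t \<noteq> list_path ys t" for t
    using assms(5) const[of t] by (cases "t < n") auto
  moreover have "(list_path xs t, list_path xs (Suc t)) \<noteq> (list_path ys (Suc t), list_path ys t)"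
    for t
    using assms(6) meet[of n] const[of t] const[of "Suc t"] by (cases "t < n") auto
  ultimately show ?thesis by (auto simp: in_collision_def)
qed

lemma in_collision_commute: "in_collision p q \<longleftrightarrow> in_collision q p"
  unfolding in_collision_def by (metis prod.inject)

definition pair_paths :: "'v list \<Rightarrow> 'v list \<Rightarrow> nat \<Rightarrow> 'v scheduled_path" where
  "pair_paths xs ys r = list_path (if r = 0 then xs else ys)"

lemma solution_pair_paths:
  assumes "robots I = {0, 1}"
    and "feasible I 0 (list_path xs)" "feasible I 1 (list_path ys)"
    and "\<not> in_collision (list_path xs) (list_path ys)"
  shows "solution I (pair_paths xs ys)"
  using assms by (auto simp: solution_def pair_paths_def in_collision_commute)

subsection \<open>Graphs with a Hamiltonian path\<close>

text \<open>The path 0, ..., \<open>n\<close> with extra edges \<open>X\<close>; the path makes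
  connectedness uniform for both instances.\<close>

definition hamiltonian_graph :: "nat \<Rightarrow> (nat \<times> nat) set \<Rightarrow> nat pair_pre_digraph" where
  "hamiltonian_graph n X =
     \<lparr>pverts = {..n}, parcs = {(u, v). v = Suc u \<and> u < n \<or> u = Suc v \<and> v < n} \<union> X \<union> X\<inverse>\<rparr>"

lemma pair_graph_hamiltonian_graph:
  assumes "X \<subseteq> {..n} \<times> {..n}" "irrefl X"
  shows "pair_graph (hamiltonian_graph n X)"
proof -
  let ?G = "hamiltonian_graph n X"
  have sub: "parcs ?G \<subseteq> {..n} \<times> {..n}"
    using assms(1) by (auto simp: hamiltonian_graph_def)
  show ?thesis
  proof
    show "finite (parcs ?G)"
      using sub by (rule finite_subset) simp
    show "symmetric (with_proj ?G)"
      by (auto simp: hamiltonian_graph_def symmetric_def sym_def)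
    show "fst e \<noteq> snd e" if "e \<in> parcs ?G" for e
      using that assms(2) by (cases e) (auto simp: hamiltonian_graph_def irrefl_def)
  qed (use sub in \<open>auto simp: hamiltonian_graph_def\<close>)
qed

lemma connected_hamiltonian_graph:
  assumes "X \<subseteq> {..n} \<times> {..n}" "irrefl X"
  shows "Digraph_Component.connected (with_proj (hamiltonian_graph n X))"
proof -
  let ?G = "hamiltonian_graph n X"
  interpret pair_graph ?G by (rule pair_graph_hamiltonian_graph[OF assms])
  have from_0: "0 \<rightarrow>\<^sup>*\<^bsub>with_proj ?G\<^esub> v" if "v \<le> n" for v
    using that
  proof (induction v)
    case 0
    show ?case by (rule reachable_refl) (simp add: hamiltonian_graph_def)
  next
    case (Suc v)
    then have "(v, Suc v) \<in> parcs ?G"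
      by (simp add: hamiltonian_graph_def)
    with Suc show ?case using reachable_adj_trans[of 0 v "Suc v"] by simp
  qed
  show ?thesis
    unfolding connected_def
  proof (rule strongly_connectedI)
    fix u v assume "u \<in> verts (with_proj (mk_symmetric (with_proj ?G)))"
      "v \<in> verts (with_proj (mk_symmetric (with_proj ?G)))"
    then have "u \<le> n" "v \<le> n" by (auto simp: hamiltonian_graph_def)
    then show "u \<rightarrow>\<^sup>*\<^bsub>with_proj (mk_symmetric (with_proj ?G))\<^esub> v"
      by (intro reachable_mk_symmetricI reachable_trans[OF symmetric_reachable'[OF from_0] from_0])
  qed (auto simp: hamiltonian_graph_def)
qed

subsection \<open>Stepping aside or walking around\<close>

text \<open>A 5-cycle 0, 1, 2, 3, 4 with the chord 1-4. Robot 0 rests at 1, between the start 0 and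
  the goal 2 of robot 1; vertex 4 serves both as refuge and as part of the detour.\<close>

definition blocked_instance :: "(nat, nat) mpp" where
  "blocked_instance =
     \<lparr>mpp_graph = hamiltonian_graph 4 {(4, 0), (4, 1)}, robots = {0, 1},
      start = (\<lambda>r. if r = 0 then 1 else 0), goal = (\<lambda>r. if r = 0 then 1 else 2)\<rparr>"

lemma mpp_instance_blocked: "mpp_instance blocked_instance"
  unfolding mpp_instance_def blocked_instance_def
  using pair_graph_hamiltonian_graph[of "{(4, 0), (4, 1)}" 4]
    connected_hamiltonian_graph[of "{(4, 0), (4, 1)}" 4]
  by (auto simp: hamiltonian_graph_def irrefl_def inj_on_def)

text \<open>The first needs 0 and 3 steps (total 3), the second 2 and 2 steps (maximum 2); in it,
  robot 0 vacates 1 just when robot 1 passes.\<close>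

lemma solutions_blocked:
  "solution blocked_instance (pair_paths [1] [0, 4, 3, 2])"
  "solution blocked_instance (pair_paths [1, 4, 1] [0, 1, 2])"
proof -
  have rob: "robots blocked_instance = {0, 1}" by (simp add: blocked_instance_def)
  show "solution blocked_instance (pair_paths [1] [0, 4, 3, 2])"
    by (intro solution_pair_paths[OF rob] feasible_list_path not_in_collision_list_path[where n = 3])
      (auto simp: blocked_instance_def hamiltonian_graph_def list_path_def numeral_eq_Suc less_Suc_eq)
  show "solution blocked_instance (pair_paths [1, 4, 1] [0, 1, 2])"
    by (intro solution_pair_paths[OF rob] feasible_list_path not_in_collision_list_path[where n = 2])
      (auto simp: blocked_instance_def hamiltonian_graph_def list_path_def numeral_eq_Suc less_Suc_eq)
qed

text \<open>Robot 1 needs two moves, which leaves robot 0 at most one, hence none. Vertex 1 then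
  stays occupied, but the only route with two moves runs through it.\<close>

lemma blocked_no_compromise:
  assumes "solution blocked_instance P" "len (P 0) + len (P 1) \<le> 3" "len (P 0) \<le> 2" "len (P 1) \<le> 2"
  shows False
proof -
  let ?I = blocked_instance
  \<comment> \<open>The distances to 2, the goal of robot 1.\<close>
  define d :: "nat \<Rightarrow> nat" where "d v = [2, 1, 0, 1, 2] ! v" for v
  have feas: "feasible ?I 0 (P 0)" "feasible ?I 1 (P 1)"
    and coll: "\<not> in_collision (P 0) (P 1)"
    using assms(1) by (auto simp: solution_def blocked_instance_def)
  have pot: "d u \<le> Suc (d v)" if "(u, v) \<in> parcs (mpp_graph ?I)" for u v
    using that by (auto simp: blocked_instance_def hamiltonian_graph_def d_def numeral_eq_Suc less_Suc_eq)
  have goal: "d (goal ?I 1) = 0" and start: "d (start ?I 1) = 2"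
    by (auto simp: blocked_instance_def d_def)
  have "len (P 1) \<ge> 2"
    using feasible_start_potential_le_len[of _ _ _ d, OF feas(2) pot goal] start by simp
  then have "P 0 t = 1" for t
    using feasible_closed_len_le_1[OF feas(1)] assms(2) by (simp add: blocked_instance_def)
  then have avoid: "P 1 t \<noteq> 1" for t
    using coll unfolding in_collision_def by metis
  \<comment> \<open>The neighbours of 0 are 1, which is blocked, and 4, which is no closer to 2; so
    robot 1 can never leave 0.\<close>
  have "P 1 t = 0" for t
  proof (induction t)
    case 0
    then show ?case using feas(2) by (simp add: feasible_def blocked_instance_def)
  next
    case (Suc t)
    show ?case
    proof (rule ccontr)
      assume "P 1 (Suc t) \<noteq> 0"
      with Suc have move: "P 1 t \<noteq> P 1 (Suc t)" by simp
      have "d (P 1 t) = Suc (d (P 1 (Suc t)))"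
        using feasible_geodesic_step[of _ _ _ d, OF feas(2) pot goal _ move] start assms(4) by simp
      moreover have "P 1 (Suc t) = 4"
        using feasible_step[OF feas(2) move] avoid[of "Suc t"] Suc
        by (auto simp: blocked_instance_def hamiltonian_graph_def)
      ultimately show False using Suc by (simp add: d_def)
    qed
  qed
  then show False
    using feasible_after_arrival[OF feas(2) order.refl] by (simp add: blocked_instance_def)
qed

subsection \<open>Waiting or walking around\<close>

text \<open>
  The corridor is the path 3, 2, 1, and 0 is a pendant vertex at 1; robot 1 can avoid
  the corridor via 6, 5, 4.
\<close>

definition corridor_instance :: "(nat, nat) mpp" where
  "corridor_instance =
     \<lparr>mpp_graph = hamiltonian_graph 7 {(7, 1)}, robots = {0, 1},
      start = (\<lambda>r. if r = 0 then 3 else 7), goal = (\<lambda>r. if r = 0 then 0 else 3)\<rparr>"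

lemma mpp_instance_corridor: "mpp_instance corridor_instance"
  unfolding mpp_instance_def corridor_instance_def
  using pair_graph_hamiltonian_graph[of "{(7, 1)}" 7]
    connected_hamiltonian_graph[of "{(7, 1)}" 7]
  by (auto simp: hamiltonian_graph_def irrefl_def inj_on_def)

definition dist_to_0 :: "nat \<Rightarrow> nat" where
  "dist_to_0 v = [0, 1, 2, 3, 4, 4, 3, 2] ! v"

definition dist_to_3 :: "nat \<Rightarrow> nat" where
  "dist_to_3 v = [3, 2, 1, 0, 1, 2, 3, 3] ! v"

lemma corridor_potentials:
  assumes "(u, v) \<in> parcs (mpp_graph corridor_instance)"
  shows "dist_to_0 u \<le> Suc (dist_to_0 v)" "dist_to_3 u \<le> Suc (dist_to_3 v)"
  using assms
  by (auto simp: corridor_instance_def hamiltonian_graph_def dist_to_0_def dist_to_3_def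
      numeral_eq_Suc less_Suc_eq)

text \<open>These lower bounds later turn bounds on totals into bounds for each robot.\<close>

lemma corridor_len_ge:
  assumes "solution corridor_instance P"
  shows "len (P 0) \<ge> 3" "len (P 1) \<ge> 3"
proof -
  have feas: "feasible corridor_instance 0 (P 0)" "feasible corridor_instance 1 (P 1)"
    using assms by (auto simp: solution_def corridor_instance_def)
  show "len (P 0) \<ge> 3"
    using feasible_start_potential_le_len[of _ _ _ dist_to_0, OF feas(1) corridor_potentials(1)]
    by (simp add: corridor_instance_def dist_to_0_def)
  show "len (P 1) \<ge> 3"
    using feasible_start_potential_le_len[of _ _ _ dist_to_3, OF feas(2) corridor_potentials(2)]
    by (simp add: corridor_instance_def dist_to_3_def)
qed

text \<open>The first has arrival times 3 and 4, with a detour of 4 moves. In the second both robots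
  make 3 moves, but robot 1 waits at 7 for two steps; after one wait it would meet robot 0 at
  1.\<close>

lemma solutions_corridor:
  "solution corridor_instance (pair_paths [3, 2, 1, 0] [7, 6, 5, 4, 3])"
  "solution corridor_instance (pair_paths [3, 2, 1, 0] [7, 7, 7, 1, 2, 3])"
proof -
  have rob: "robots corridor_instance = {0, 1}" by (simp add: corridor_instance_def)
  show "solution corridor_instance (pair_paths [3, 2, 1, 0] [7, 6, 5, 4, 3])"
    by (intro solution_pair_paths[OF rob] feasible_list_path not_in_collision_list_path[where n = 4])
      (auto simp: corridor_instance_def hamiltonian_graph_def list_path_def numeral_eq_Suc less_Suc_eq)
  show "solution corridor_instance (pair_paths [3, 2, 1, 0] [7, 7, 7, 1, 2, 3])"
    by (intro solution_pair_paths[OF rob] feasible_list_path not_in_collision_list_path[where n = 5])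
      (auto simp: corridor_instance_def hamiltonian_graph_def list_path_def numeral_eq_Suc less_Suc_eq)
qed

text \<open>Three moves within four steps leave each robot at most one wait, too little to clear the
  corridor.\<close>

lemma corridor_no_compromise:
  assumes "solution corridor_instance P"
    and "len (P 0) \<le> 3" "len (P 1) \<le> 3"
    and "arrival_time corridor_instance 0 (P 0) \<le> 4" "arrival_time corridor_instance 1 (P 1) \<le> 4"
  shows False
proof -
  let ?I = corridor_instance and ?p = "P 0" and ?q = "P 1"
  have feas: "feasible ?I 0 ?p" "feasible ?I 1 ?q"
    and coll: "\<not> in_collision ?p ?q"
    using assms(1) by (auto simp: solution_def corridor_instance_def)
  \<comment> \<open>Moves must decrease \<open>dist_to_0\<close>, so robot 0 cannot turn off to 4 or
    7; at 0 the truncated subtraction means staying.\<close>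
  have p_step: "?p (Suc t) \<in> {?p t, ?p t - 1}" if "?p t \<le> 3" for t
  proof (cases "?p t = ?p (Suc t)")
    case False
    have "dist_to_0 (?p t) = Suc (dist_to_0 (?p (Suc t)))"
      using feasible_geodesic_step[of _ _ _ dist_to_0, OF feas(1) corridor_potentials(1) _ _ False] assms(2)
      by (simp add: corridor_instance_def dist_to_0_def)
    with feasible_step[OF feas(1) False] that show ?thesis
      by (auto simp: corridor_instance_def hamiltonian_graph_def dist_to_0_def numeral_eq_Suc le_Suc_eq)
  qed simp
  have q_step: "?q (Suc t) \<in> {?q t, if ?q t = 7 then 1 else Suc (?q t)}"
    if "?q t \<in> {7, 1, 2, 3}" for t
  proof (cases "?q t = ?q (Suc t)")
    case False
    have "dist_to_3 (?q t) = Suc (dist_to_3 (?q (Suc t)))"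
      using feasible_geodesic_step[of _ _ _ dist_to_3, OF feas(2) corridor_potentials(2) _ _ False] assms(3)
      by (simp add: corridor_instance_def dist_to_3_def)
    with feasible_step[OF feas(2) False] that show ?thesis
      by (auto simp: corridor_instance_def hamiltonian_graph_def dist_to_3_def)
  qed simp
  have p: "?p 0 = 3" "?p 4 = 0" and q: "?q 0 = 7" "?q 4 = 3"
    using feas feasible_after_arrival[OF feas(1) assms(4)] feasible_after_arrival[OF feas(2) assms(5)]
    by (auto simp: feasible_def corridor_instance_def)
  have nums: "Suc 0 = 1" "Suc 1 = 2" "Suc 2 = 3" "Suc 3 = (4::nat)" by simp_all
  \<comment> \<open>The cases are: the single wait falls in the first two steps, or in the last two.
    The same split gives \<open>q_cases\<close>.\<close>
  have p_cases: "?p 2 = 2 \<and> ?p 3 = 1 \<or> ?p 1 = 2 \<and> ?p 2 = 1"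
    using p p_step[of 0] p_step[of 1] p_step[of 2] p_step[of 3] unfolding nums
    by auto
  have q_cases: "?q 2 = 1 \<and> ?q 3 = 2 \<or> ?q 1 = 1 \<and> ?q 2 = 2"
    using q q_step[of 0] q_step[of 1] q_step[of 2] q_step[of 3] unfolding nums
    by (auto split: if_splits)
  have "?p t \<noteq> ?q t" "?p t \<noteq> ?q (Suc t) \<or> ?p (Suc t) \<noteq> ?q t" for t
    using coll by (auto simp: in_collision_def)
  \<comment> \<open>If both wait early or both wait late, they swap 1 and 2 at time 2 or 1,
    respectively; otherwise they meet at time 2.\<close>
  from this(1)[of 2] this(2)[of 1] this(2)[of 2] show False
    using p_cases q_cases unfolding nums by auto
qed

subsection \<open>The four objectives\<close>

definition jointly_minimizable :: "('v, 'r) mpp \<Rightarrow> objective \<Rightarrow> objective \<Rightarrow> bool" where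
  "jointly_minimizable I k l \<longleftrightarrow>
     (\<exists>P. is_arg_min (cost I k) (solution I) P \<and> is_arg_min (cost I l) (solution I) P)"

lemma jointly_minimizable_commute: "jointly_minimizable I k l \<longleftrightarrow> jointly_minimizable I l k"
  by (auto simp: jointly_minimizable_def)

text \<open>A joint minimizer is at least as good as \<open>A\<close> for \<open>k\<close> and as
  \<open>B\<close> for \<open>l\<close>, so the actual minima need not be computed.\<close>

lemma jointly_minimizableE:
  assumes "jointly_minimizable I k l" "solution I A" "solution I B"
  obtains P where "solution I P" "cost I k P \<le> cost I k A" "cost I l P \<le> cost I l B"
  using assms by (auto simp: jointly_minimizable_def is_arg_min_linorder)

lemma cost_two_robots:
  assumes "robots I = {0, 1 :: nat}"
  shows "cost I Total_Arrival_Time P = arrival_time I 0 (P 0) + arrival_time I 1 (P 1)"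
    and "cost I Total_Distance P = len (P 0) + len (P 1)"
    and "cost I Makespan P = max (arrival_time I 0 (P 0)) (arrival_time I 1 (P 1))"
    and "cost I Maximum_Distance P = max (len (P 0)) (len (P 1))"
  using assms by simp_all

lemma blocked_not_jointly_minimizable:
  assumes "k \<in> {Total_Arrival_Time, Total_Distance}" "l \<in> {Makespan, Maximum_Distance}"
  shows "\<not> jointly_minimizable blocked_instance k l"
proof
  let ?I = blocked_instance
  let ?A = "pair_paths [1] [0, 4, 3, 2] :: nat \<Rightarrow> nat scheduled_path"
  let ?B = "pair_paths [1, 4, 1] [0, 1, 2] :: nat \<Rightarrow> nat scheduled_path"
  assume "jointly_minimizable ?I k l"
  have rob: "robots ?I = {0, 1}" by (simp add: blocked_instance_def)
  note costs = cost_two_robots[OF rob]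
  have goal: "goal ?I 0 = 1" "goal ?I 1 = 2" by (simp_all add: blocked_instance_def)
  obtain P where P: "solution ?I P" "cost ?I k P \<le> cost ?I k ?A" "cost ?I l P \<le> cost ?I l ?B"
    using jointly_minimizableE[OF \<open>jointly_minimizable ?I k l\<close> solutions_blocked] .
  have feas: "feasible ?I 0 (P 0)" "feasible ?I 1 (P 1)"
    using P(1) by (auto simp: solution_def rob)
  note len_arrival = feas[THEN feasible_len_le_arrival_time]
  have "cost ?I k ?A \<le> 3"
    using assms(1) goal arrival_time_list_path[of "[1]" ?I 0] arrival_time_list_path[of "[0, 4, 3, 2]" ?I 1]
      len_list_path[of "[1::nat]"] len_list_path[of "[0, 4, 3, 2::nat]"]
    by (auto simp: costs pair_paths_def simp del: cost.simps)
  \<comment> \<open>For arrival times the bound passes to lengths, so all four pairs lead to one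
    contradiction.\<close>
  then have "len (P 0) + len (P 1) \<le> 3"
    using P(2) assms(1) len_arrival by (auto simp: costs simp del: cost.simps)
  moreover have "cost ?I l ?B \<le> 2"
    using assms(2) goal arrival_time_list_path[of "[1, 4, 1]" ?I 0] arrival_time_list_path[of "[0, 1, 2]" ?I 1]
      len_list_path[of "[1, 4, 1::nat]"] len_list_path[of "[0, 1, 2::nat]"]
    by (auto simp: costs pair_paths_def simp del: cost.simps)
  then have "len (P 0) \<le> 2" "len (P 1) \<le> 2"
    using P(3) assms(2) len_arrival by (auto simp: costs simp del: cost.simps)
  ultimately show False
    using blocked_no_compromise[OF P(1)] by blast
qed

lemma corridor_not_jointly_minimizable:
  assumes "k \<in> {Total_Arrival_Time, Makespan}" "l \<in> {Total_Distance, Maximum_Distance}"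
  shows "\<not> jointly_minimizable corridor_instance k l"
proof
  let ?I = corridor_instance
  let ?A = "pair_paths [3, 2, 1, 0] [7, 6, 5, 4, 3] :: nat \<Rightarrow> nat scheduled_path"
  let ?B = "pair_paths [3, 2, 1, 0] [7, 7, 7, 1, 2, 3] :: nat \<Rightarrow> nat scheduled_path"
  assume "jointly_minimizable ?I k l"
  have rob: "robots ?I = {0, 1}" by (simp add: corridor_instance_def)
  note costs = cost_two_robots[OF rob]
  have goal: "goal ?I 0 = 0" "goal ?I 1 = 3" by (simp_all add: corridor_instance_def)
  obtain P where P: "solution ?I P" "cost ?I k P \<le> cost ?I k ?A" "cost ?I l P \<le> cost ?I l ?B"
    using jointly_minimizableE[OF \<open>jointly_minimizable ?I k l\<close> solutions_corridor] .
  have feas: "feasible ?I 0 (P 0)" "feasible ?I 1 (P 1)"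
    using P(1) by (auto simp: solution_def rob)
  note len_arrival = feas[THEN feasible_len_le_arrival_time] and len_ge = corridor_len_ge[OF P(1)]
  have "cost ?I k ?A \<le> (if k = Makespan then 4 else 7)"
    using assms(1) goal arrival_time_list_path[of "[3, 2, 1, 0]" ?I 0]
      arrival_time_list_path[of "[7, 6, 5, 4, 3]" ?I 1]
    by (auto simp: costs pair_paths_def simp del: cost.simps)
  \<comment> \<open>If the total is at most 7, each summand is at most 4 because the other is at
    least 3.\<close>
  then have "arrival_time ?I 0 (P 0) \<le> 4" "arrival_time ?I 1 (P 1) \<le> 4"
    using P(2) assms(1) len_arrival len_ge by (auto simp: costs simp del: cost.simps)
  \<comment> \<open>The bound by the list length would give 5, counting the two waits; the moves
    occur only at times 2, 3, 4.\<close>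
  moreover have "len (list_path [7, 7, 7, 1, 2, 3 :: nat]) \<le> card {2, 3, 4 :: nat}"
  proof (rule len_le_card)
    fix t assume *: "list_path [7, 7, 7, 1, 2, 3 :: nat] t \<noteq> list_path [7, 7, 7, 1, 2, 3] (Suc t)"
    then have "t < 5" using list_path_move by fastforce
    with * show "t \<in> {2, 3, 4}"
      by (auto simp: list_path_def numeral_eq_Suc less_Suc_eq)
  qed simp
  then have "cost ?I l ?B \<le> (if l = Maximum_Distance then 3 else 6)"
    using assms(2) len_list_path[of "[3, 2, 1, 0::nat]"]
    by (auto simp: costs pair_paths_def simp del: cost.simps)
  then have "len (P 0) \<le> 3" "len (P 1) \<le> 3"
    using P(3) assms(2) len_ge by (auto simp: costs simp del: cost.simps)
  ultimately show False
    using corridor_no_compromise[OF P(1)] by blast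
qed

theorem theorem4:
  fixes k l :: objective
  assumes "k \<noteq> l"
  shows "\<exists>I :: (nat, nat) mpp.
           mpp_instance I \<and> (\<exists>P. solution I P) \<and>
           \<not> (\<exists>P. is_arg_min (cost I k) (solution I) P \<and> is_arg_min (cost I l) (solution I) P)"
proof -
  \<comment> \<open>The blocked instance separates totals from maxima, the corridor separates
    arrival times from distances; two distinct objectives differ in at least one of these
    respects.\<close>
  consider "\<not> jointly_minimizable blocked_instance k l"
    | "\<not> jointly_minimizable corridor_instance k l"
    using assms blocked_not_jointly_minimizable[of k l] blocked_not_jointly_minimizable[of l k]
      corridor_not_jointly_minimizable[of k l] corridor_not_jointly_minimizable[of l k]
    unfolding jointly_minimizable_commute[of _ l k] by (cases k; cases l; simp)
  then show ?thesis
    using mpp_instance_blocked mpp_instance_corridor solutions_blocked solutions_corridor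
    unfolding jointly_minimizable_def by cases blast+
qed

end
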